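(* Let $G$ be a connected graph with $n$ vertices and Laplacian matrix $L$, with eigenvalues $0=\lambda_1<\lambda_2\le\cdots\le\lambda_n$. For $1\le k\le n$ let $V_{\lambda_k}$ be the eigenspace of $L$ for $\lambda_k$ and $V_{\lambda_k}^{\perp}$ its orthogonal complement in $\mathbb R^n$. Let $\sigma_2=\{k: 3\le k\le n,\ \lambda_k>\lambda_2\}$ and $\sigma_n=\{k: 2\le k\le n-1,\ \lambda_k<\lambda_n\}$. Then for any two distinct vertices $u,v$ of $G$, $$\sqrt2\,\lambda_n^{-1}\le d_B(u,v)\le \sqrt2\,\lambda_2^{-1},$$ and for $j\in\{2,n\}$, $d_B(u,v)=\sqrt2\,\lambda_j^{-1}$ if and only if $G\cong K_n$ or $\delta_u-\delta_v\in V_{\lambda_k}^{\perp}$ for every $k\in\sigma_j$.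
   Context: All graphs are finite, simple and undirected. The Laplacian matrix of $G$ is $L=D-A$ ($A$ adjacency matrix, $D$ diagonal degree matrix). $L^{+}$ is the Moore–Penrose inverse of $L$ and $L^{2+}=(L^{+})^2$. The biharmonic distance is the nonnegative number $d_B(u,v)$ with $d_B^2(u,v)=L^{2+}_{uu}+L^{2+}_{vv}-2L^{2+}_{uv}$. $\delta_u$ denotes the standard unit vector with a $1$ in coordinate $u$. $K_n$ is the complete graph on $n$ vertices. *)

theory Defs
  imports "HOL-Analysis.Analysis" "Graph_Theory.Graph_Theory"
begin

text \<open>
  A finite simple undirected graph is a term satisfying the locale predicate \<open>graph\<close> of
  \<open>Graph_Theory\<close>: a finite, symmetric digraph without loops and without parallel arcs.
  Matrices and vectors are indexed by the vertex type, so the definitions below are intended for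
  graphs whose vertex set is all of a finite type.
\<close>

definition adjacency_matrix :: "('n::finite, 'b) pre_digraph \<Rightarrow> real^'n^'n" where
  "adjacency_matrix G = (\<chi> i j. if i \<rightarrow>\<^bsub>G\<^esub> j then 1 else 0)"

text \<open>An undirected edge is a pair of opposite arcs, so \<open>out_degree\<close> is the degree.\<close>

definition degree_matrix :: "('n::finite, 'b) pre_digraph \<Rightarrow> real^'n^'n" where
  "degree_matrix G = (\<chi> i j. if i = j then real (out_degree G i) else 0)"

definition laplacian :: "('n::finite, 'b) pre_digraph \<Rightarrow> real^'n^'n" where
  "laplacian G = degree_matrix G - adjacency_matrix G"

definition is_moore_penrose :: "real^'n^'m \<Rightarrow> real^'m^'n \<Rightarrow> bool" where
  "is_moore_penrose A X \<longleftrightarrow>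
     A ** X ** A = A \<and> X ** A ** X = X \<and>
     transpose (A ** X) = A ** X \<and> transpose (X ** A) = X ** A"

definition moore_penrose :: "real^'n^'m \<Rightarrow> real^'m^'n" where
  "moore_penrose A = (THE X. is_moore_penrose A X)"

definition biharmonic_distance :: "('n::finite, 'b) pre_digraph \<Rightarrow> 'n \<Rightarrow> 'n \<Rightarrow> real" where
  "biharmonic_distance G u v =
     (let M = moore_penrose (laplacian G) ** moore_penrose (laplacian G)
      in sqrt (M $ u $ u + M $ v $ v - 2 * M $ u $ v))"

text \<open>
  \<open>ordered_eigenvalues A lam\<close>: the values \<open>lam 1 \<le> \<dots> \<le> lam n\<close> are the eigenvalues of \<open>A\<close>, repeated
  according to their multiplicity as roots of the characteristic polynomial \<open>det (x I - A)\<close>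
  (\<open>mat x\<close> is \<open>x I\<close>); other values of \<open>lam\<close> are irrelevant.
\<close>

definition ordered_eigenvalues :: "real^'n^'n \<Rightarrow> (nat \<Rightarrow> real) \<Rightarrow> bool" where
  "ordered_eigenvalues A lam \<longleftrightarrow>
     mono_on {1..CARD('n)} lam \<and>
     (\<forall>x. det (mat x - A) = (\<Prod>k = 1..CARD('n). (x - lam k)))"

definition eigenspace :: "real^'n^'n \<Rightarrow> real \<Rightarrow> (real^'n) set" where
  "eigenspace A \<mu> = {x. A *v x = \<mu> *s x}"

definition complete_graph :: "nat \<Rightarrow> nat pair_pre_digraph" where
  "complete_graph n =
     \<lparr>pverts = {..<n}, parcs = {(i, j). i < n \<and> j < n \<and> i \<noteq> j}\<rparr>"

lemma complete_digraph_complete_graph: "complete_digraph n (with_proj (complete_graph n))"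
  by (auto simp: complete_digraph_pair_def complete_graph_def)

end

theory Submission
  imports Defs
begin

text \<open>
  Choose an orthonormal eigenbasis \<open>q\<^sub>1, \<dots>, q\<^sub>n\<close> of \<open>L\<close> with \<open>L q\<^sub>k = \<lambda>\<^sub>k q\<^sub>k\<close> and put
  \<open>w = \<delta>\<^sub>u - \<delta>\<^sub>v\<close>. Since \<open>L\<^sup>+\<close> is symmetric, \<open>d\<^sub>B(u, v)\<close> is the norm of \<open>L\<^sup>+ w\<close>, so its square is
  the sum of \<open>(q\<^sub>k \<bullet> w)\<^sup>2 / \<lambda>\<^sub>k\<^sup>2\<close> over \<open>k \<ge> 2\<close>. By connectedness \<open>q\<^sub>1\<close> is constant, hence orthogonal to
  \<open>w\<close>, and the weights \<open>(q\<^sub>k \<bullet> w)\<^sup>2\<close> with \<open>k \<ge> 2\<close> sum to \<open>w \<bullet> w = 2\<close>. Both bounds follow, with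
  equality exactly if all the weight sits on the extremal eigenvalue. For \<open>K\<^sub>n\<close> all nonzero
  eigenvalues equal \<open>n\<close>, so its index sets \<open>\<sigma>\<^sub>j\<close> are empty and the disjunct \<open>G \<cong> K\<^sub>n\<close> is a special
  case of the orthogonality condition.
\<close>

subsection \<open>Spectral theorem for real symmetric matrices\<close>

text \<open>Variational argument: a maximiser \<open>b\<close> of \<open>x \<bullet> f x\<close> on
  the compact unit sphere of \<open>S\<close> is an eigenvector. Invariance of \<open>S\<close>
  keeps the residual \<open>r\<close> in \<open>S\<close>, so \<open>r\<close> is an admissible
  direction of variation.\<close>

lemma self_adjoint_eigenvector:
  fixes f :: "'a::euclidean_space \<Rightarrow> 'a"
  assumes lin: "linear f" and sa: "\<And>x y. f x \<bullet> y = x \<bullet> f y"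
    and S: "subspace S" "S \<noteq> {0}" and inv: "f ` S \<subseteq> S"
  obtains b \<mu> where "b \<in> S" "norm b = 1" "f b = \<mu> *\<^sub>R b"
proof -
  have "compact (S \<inter> sphere 0 1)"
    by (simp add: S(1) closed_Int_compact closed_subspace)
  moreover have "S \<inter> sphere 0 1 \<noteq> {}"
  proof -
    obtain x where x: "x \<in> S" "x \<noteq> 0"
      using S subspace_0 by blast
    then have "x /\<^sub>R norm x \<in> S \<inter> sphere 0 1"
      by (simp add: S(1) subspace_scale)
    then show ?thesis by blast
  qed
  moreover have "continuous_on (S \<inter> sphere 0 1) (\<lambda>x. x \<bullet> f x)"
    by (intro continuous_intros linear_continuous_on lin linear_conv_bounded_linear[THEN iffD1])
  ultimately obtain b where b: "b \<in> S \<inter> sphere 0 1"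
    and max: "\<And>x. x \<in> S \<inter> sphere 0 1 \<Longrightarrow> x \<bullet> f x \<le> b \<bullet> f b"
    using continuous_attains_sup by metis
  have [simp]: "b \<bullet> b = 1"
    using b by (simp add: norm_eq_1)
  define \<mu> where "\<mu> = b \<bullet> f b"
  define g where "g x = \<mu> * (x \<bullet> x) - x \<bullet> f x" for x
  have g_nonneg: "g x \<ge> 0" if "x \<in> S" for x
  proof (cases "x = 0")
    case False
    then have "x /\<^sub>R norm x \<in> S \<inter> sphere 0 1"
      using that by (simp add: S(1) subspace_scale)
    from max[OF this] show ?thesis
      using False
      by (simp add: g_def \<mu>_def linear_scale[OF lin] field_simps power2_norm_eq_inner[symmetric] power2_eq_square)
  qed (simp add: g_def)
  \<comment> \<open>\<open>g\<close> is nonnegative on \<open>S\<close> and vanishes at \<open>b\<close>, so its derivative \<open>2 (r \<bullet> r)\<close> at \<open>b\<close> in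
    direction \<open>r\<close> must vanish.\<close>
  define r where "r = \<mu> *\<^sub>R b - f b"
  have r: "r \<in> S"
    using b inv by (auto simp: r_def intro!: subspace_diff subspace_scale S(1))
  have expand: "g (b + t *\<^sub>R r) = 2 * t * (r \<bullet> r) + t\<^sup>2 * g r" for t
  proof -
    have "r \<bullet> r = \<mu> * (b \<bullet> r) - f b \<bullet> r"
      by (metis inner_diff_left inner_scaleR_left r_def)
    then show ?thesis
      using sa[of b r]
      by (simp add: g_def linear_add[OF lin] linear_scale[OF lin] inner_add_left inner_add_right
          inner_commute[of r b] inner_commute[of r "f b"] power2_eq_square)
        (simp add: \<mu>_def algebra_simps)
  qed
  have "r \<bullet> r = 0"
  proof (rule ccontr)
    assume nz: "r \<bullet> r \<noteq> 0"
    define R where "R = r \<bullet> r"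
    have R: "R > 0" using nz by (simp add: R_def)
    have gr: "g r \<ge> 0" using g_nonneg r by blast
    \<comment> \<open>A negative step at which the linear term outweighs the quadratic one; the
      \<open>+ 1\<close> keeps the denominator positive when \<open>g r = 0\<close>.\<close>
    define t where "t = - (R / (g r + 1))"
    have "b + t *\<^sub>R r \<in> S"
      using b r by (auto intro: subspace_add subspace_scale S(1))
    then have "0 \<le> 2 * t * R + t\<^sup>2 * g r"
      using g_nonneg expand R_def by metis
    also have "\<dots> = - (R\<^sup>2 * (g r + 2)) / (g r + 1)\<^sup>2"
    proof -
      have "g r + 1 \<noteq> 0" using gr by simp
      then show ?thesis
        by (simp add: t_def divide_simps power2_eq_square) (simp add: algebra_simps)
    qed
    also have "\<dots> < 0"
      using R gr by (simp add: divide_less_0_iff)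
    finally show False by simp
  qed
  then have "f b = \<mu> *\<^sub>R b" by (simp add: r_def)
  then show ?thesis using that b by auto
qed

text \<open>Induction on the dimension: split off one eigenvector; self-adjointness makes its
  orthogonal complement within \<open>S\<close> invariant again.\<close>

lemma self_adjoint_eigenbasis:
  fixes f :: "'a::euclidean_space \<Rightarrow> 'a"
  assumes lin: "linear f" and sa: "\<And>x y. f x \<bullet> y = x \<bullet> f y"
    and "subspace S" "f ` S \<subseteq> S"
  shows "\<exists>B. B \<subseteq> S \<and> pairwise orthogonal B \<and> (\<forall>b\<in>B. norm b = 1 \<and> (\<exists>\<mu>. f b = \<mu> *\<^sub>R b)) \<and> span B = S"
  using assms(3,4)
proof (induction "dim S" arbitrary: S rule: less_induct)
  case less
  show ?case
  proof (cases "S = {0}")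
    case True
    then show ?thesis by (intro exI[of _ "{}"]) auto
  next
    case False
    obtain b \<mu> where b: "b \<in> S" "norm b = 1" "f b = \<mu> *\<^sub>R b"
      using self_adjoint_eigenvector[OF lin sa less.prems(1) False less.prems(2)] by metis
    define T where "T = {x \<in> S. b \<bullet> x = 0}"
    have T: "subspace T"
      using less.prems(1) unfolding T_def subspace_def by (auto simp: inner_add_right)
    have bT: "b \<notin> T"
      using b(2) by (auto simp: T_def norm_eq_1)
    have "T \<subset> S"
      using b(1) bT unfolding T_def by blast
    then have "dim T < dim S"
      by (metis T dim_psubset less.prems(1) span_eq_iff)
    moreover have "f ` T \<subseteq> T"
      using less.prems(2) b(3) by (auto simp: T_def sa[symmetric])
    ultimately obtain B where B: "B \<subseteq> T" "pairwise orthogonal B"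
      "\<forall>b\<in>B. norm b = 1 \<and> (\<exists>\<mu>. f b = \<mu> *\<^sub>R b)" "span B = T"
      using less.hyps T by meson
    have "S \<subseteq> span (insert b B)"
    proof
      fix x assume x: "x \<in> S"
      have "x - (b \<bullet> x) *\<^sub>R b \<in> T"
        using x b by (auto simp: T_def inner_diff_right norm_eq_1
            intro!: subspace_diff subspace_scale less.prems(1))
      then show "x \<in> span (insert b B)"
        unfolding span_insert B(4) by blast
    qed
    moreover have "span (insert b B) \<subseteq> S"
      using b(1) B(1) \<open>T \<subset> S\<close> less.prems(1) by (intro span_minimal) auto
    moreover have "pairwise orthogonal (insert b B)"
      using B(1,2) by (auto simp: pairwise_insert T_def orthogonal_def inner_commute)
    ultimately show ?thesis
      using b B(1,3) \<open>T \<subset> S\<close> by (intro exI[of _ "insert b B"]) auto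
  qed
qed

lemma symmetric_matrix_inner:
  fixes A :: "real^'n^'n"
  assumes "transpose A = A"
  shows "(A *v x) \<bullet> y = x \<bullet> (A *v y)"
  by (metis assms dot_lmul_matrix transpose_matrix_vector)

lemma symmetric_matrix_orthonormal_eigenbasis:
  fixes A :: "real^'n^'n"
  assumes "transpose A = A"
  obtains p \<mu> where "\<And>i j. p i \<bullet> p j = (if i = j then 1 else 0)"
    "\<And>j::'n. A *v p j = \<mu> j *s p j"
proof -
  obtain B where B: "pairwise orthogonal B" "\<forall>b\<in>B. norm b = 1 \<and> (\<exists>\<mu>. A *v b = \<mu> *\<^sub>R b)"
      "span B = (UNIV :: (real^'n) set)"
    using self_adjoint_eigenbasis[of "(*v) A" UNIV] symmetric_matrix_inner[OF assms] by auto
  have "0 \<notin> B" using B(2) by fastforce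
  then have ind: "independent B" using B(1) pairwise_orthogonal_independent by blast
  then have "card B = CARD('n)"
    using B(3) by (metis dim_UNIV dim_span_eq_card_independent DIM_cart DIM_real mult.right_neutral dim_eq_card_independent dim_span)
  moreover have "finite B" using ind by (rule independent_imp_finite)
  ultimately obtain p where p: "bij_betw p (UNIV::'n set) B"
    by (metis finite_same_card_bij finite)
  have pB: "p i \<in> B" for i using p bij_betwE by blast
  have "p i \<bullet> p j = (if i = j then 1 else 0)" for i j
  proof (cases "i = j")
    case True
    then show ?thesis using B(2) pB by (simp add: norm_eq_1)
  next
    case False
    then have "p i \<noteq> p j" using p by (auto simp: bij_betw_def inj_on_def)
    then show ?thesis using B(1) pB False by (auto simp: pairwise_def orthogonal_def)
  qed
  moreover have "\<exists>\<mu>. A *v p j = \<mu> *s p j" for j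
    using B(2) pB by (metis scalar_mult_eq_scaleR)
  ultimately show ?thesis using that by metis
qed

section \<open>Characteristic polynomial and the labelling of an eigenbasis by
  \<open>lam\<close>\<close>

lemma mat_vector_mult: "mat c *v x = c *s (x :: 'a::semiring_1^'n)"
proof -
  have "(\<Sum>j\<in>UNIV. (if i = j then c else 0) * x $ j) = (\<Sum>j\<in>UNIV. if i = j then c * x $ j else 0)" for i
    by (rule sum.cong) auto
  then show ?thesis
    by (simp add: vec_eq_iff matrix_vector_mult_def mat_def)
qed

text \<open>The matrix with columns \<open>p j\<close> diagonalises \<open>A\<close>; its
  determinant is nonzero by orthonormality and cancels.\<close>

lemma charpoly_orthonormal_eigenbasis:
  fixes A :: "real^'n^'n"
  assumes p: "\<And>i j. p i \<bullet> p j = (if i = j then 1 else 0)"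
    and ev: "\<And>j::'n. A *v p j = \<mu> j *s p j"
  shows "det (mat x - A) = (\<Prod>j\<in>UNIV. x - \<mu> j)"
proof -
  define P :: "real^'n^'n" where "P = (\<chi> i j. p j $ i)"
  have P: "transpose P ** P = mat 1"
    using p by (simp add: P_def vec_eq_iff matrix_matrix_mult_def transpose_def mat_def inner_vec_def)
  have "(mat x - A) ** P = P ** (\<chi> i j. if i = j then x - \<mu> j else 0)" (is "_ = P ** ?D")
  proof -
    have "((mat x - A) ** P) $ i $ j = (P ** ?D) $ i $ j" for i j
    proof -
      have "((mat x - A) ** P) $ i $ j = ((mat x - A) *v p j) $ i"
        by (simp add: matrix_matrix_mult_def matrix_vector_mult_def P_def)
      also have "(mat x - A) *v p j = x *s p j - \<mu> j *s p j"
        by (simp only: matrix_vector_mult_diff_rdistrib ev mat_vector_mult)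
      also have "\<dots> $ i = p j $ i * (x - \<mu> j)"
        by (simp add: right_diff_distrib mult.commute)
      also have "\<dots> = (P ** ?D) $ i $ j"
        by (simp add: matrix_matrix_mult_def P_def mult_delta_right)
      finally show ?thesis .
    qed
    then show ?thesis by (simp add: vec_eq_iff)
  qed
  from arg_cong[OF this, of det] have "det (mat x - A) * det P = det P * det ?D"
    by (simp only: det_mul)
  moreover have "det P \<noteq> 0"
    using arg_cong[OF P, of det] by (auto simp only: det_mul det_I)
  moreover have "det ?D = (\<Prod>j\<in>UNIV. x - \<mu> j)"
    by (subst det_diagonal) simp_all
  ultimately show ?thesis by simp
qed

text \<open>Unique factorisation into linear factors; a bijection of index sets, unlike equality of
  root sets, records multiplicities.\<close>

lemma linear_factors_unique:
  fixes a :: "'i \<Rightarrow> real" and b :: "'j \<Rightarrow> real"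
  assumes "finite I" "finite J"
    and "(\<Prod>i\<in>I. [:- a i, 1:]) = (\<Prod>j\<in>J. [:- b j, 1:])"
  shows "\<exists>f. bij_betw f I J \<and> (\<forall>i\<in>I. a i = b (f i))"
  using assms
proof (induction I arbitrary: J rule: finite_induct)
  case empty
  have "J = {}"
  proof (rule ccontr)
    assume "J \<noteq> {}"
    then obtain j where "j \<in> J" by blast
    then have "poly (\<Prod>j\<in>J. [:- b j, 1:]) (b j) = 0"
      using empty.prems(1) by (auto simp: poly_prod)
    moreover have "(\<Prod>j\<in>J. [:- b j, 1:]) = 1"
      using empty.prems(2) by simp
    ultimately show False by (metis poly_1 zero_neq_one)
  qed
  then show ?case by (auto simp: bij_betw_def)
next
  case (insert k I)
  have "poly (\<Prod>i\<in>insert k I. [:- a i, 1:]) (a k) = 0"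
    using insert.hyps by (simp add: poly_prod)
  then obtain j where j: "j \<in> J" "a k = b j"
    using insert.prems by (auto simp: poly_prod)
  \<comment> \<open>The common factor is cancelled as a polynomial; values at the root
    \<open>b j\<close> would not allow this.\<close>
  have "[:- b j, 1:] * (\<Prod>i\<in>I. [:- a i, 1:]) = (\<Prod>i\<in>insert k I. [:- a i, 1:])"
    using insert.hyps j by simp
  also have "\<dots> = [:- b j, 1:] * (\<Prod>j\<in>J - {j}. [:- b j, 1:])"
    unfolding insert.prems(2) using insert.prems(1) j(1) by (rule prod.remove)
  finally have "(\<Prod>i\<in>I. [:- a i, 1:]) = (\<Prod>j\<in>J - {j}. [:- b j, 1:])"
    by (rule mult_left_cancel[THEN iffD1, rotated]) simp
  then obtain f where f: "bij_betw f I (J - {j})" "\<forall>i\<in>I. a i = b (f i)"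
    using insert.IH[of "J - {j}"] insert.prems by blast
  have "bij_betw (f(k := j)) ({k} \<union> I) ({j} \<union> (J - {j}))"
  proof (rule bij_betw_combine)
    show "bij_betw (f(k := j)) I (J - {j})"
      using f(1) insert.hyps(2) by (subst bij_betw_cong[of _ _ f]) auto
  qed auto
  then show ?case
    using f(2) j insert.hyps
    by (intro exI[of _ "f(k := j)"]) (simp add: insert_absorb del: fun_upd_apply, auto)
qed

text \<open>A spectral decomposition with one vector per index, so a repeated eigenvalue occurs once
  for each of its vectors. \<open>expansion\<close> expresses completeness.\<close>

locale symmetric_eigenbasis =
  fixes A :: "real^'n^'n" and I :: "'i set" and lam :: "'i \<Rightarrow> real" and q :: "'i \<Rightarrow> real^'n"
  assumes symmetric: "transpose A = A"
    and finite_index: "finite I"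
    and orthonormal: "\<lbrakk>i \<in> I; j \<in> I\<rbrakk> \<Longrightarrow> q i \<bullet> q j = (if i = j then 1 else 0)"
    and eigenvector: "k \<in> I \<Longrightarrow> A *v q k = lam k *s q k"
    and expansion: "x = (\<Sum>k\<in>I. (q k \<bullet> x) *s q k)"

text \<open>The characteristic polynomial fixes the eigenvalues of any orthonormal eigenbasis up to
  a permutation, so the basis can be relabelled to match \<open>lam\<close>.\<close>

lemma ordered_eigenvalues_eigenbasis:
  fixes A :: "real^'n^'n"
  assumes A: "transpose A = A" and lam: "ordered_eigenvalues A lam"
  obtains q where "symmetric_eigenbasis A {1..CARD('n)} lam q"
proof -
  obtain p \<mu> where p: "\<And>i j. p i \<bullet> p j = (if i = j then 1 else 0)"
    and ev: "\<And>j::'n. A *v p j = \<mu> j *s p j"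
    using symmetric_matrix_orthonormal_eigenbasis[OF A] by metis
  have "poly (\<Prod>k = 1..CARD('n). [:- lam k, 1:]) x = poly (\<Prod>j\<in>UNIV. [:- \<mu> j, 1:]) x" for x
  proof -
    have "(\<Prod>k = 1..CARD('n). x - lam k) = (\<Prod>j\<in>UNIV. x - \<mu> j)"
      using lam charpoly_orthonormal_eigenbasis[OF p ev, of x]
      by (simp add: ordered_eigenvalues_def)
    then show ?thesis by (simp add: poly_prod)
  qed
  then have "(\<Prod>k = 1..CARD('n). [:- lam k, 1:]) = (\<Prod>j\<in>UNIV. [:- \<mu> j, 1:])"
    by (intro poly_ext)
  then obtain f where f: "bij_betw f {1..CARD('n)} (UNIV::'n set)"
    and fl: "\<forall>k\<in>{1..CARD('n)}. lam k = \<mu> (f k)"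
    using linear_factors_unique[OF finite_atLeastAtMost finite] by blast
  define P :: "real^'n^'n" where "P = (\<chi> i j. p i $ j)"
  have "P ** transpose P = mat 1"
    using p by (simp add: P_def vec_eq_iff matrix_matrix_mult_def transpose_def mat_def inner_vec_def)
  \<comment> \<open>Orthonormal rows of a square matrix force orthonormal columns; this is the
    completeness of the basis.\<close>
  then have "transpose P ** P = mat 1"
    by (rule matrix_left_right_inverse[THEN iffD1])
  have expand: "x = (\<Sum>k\<in>{1..CARD('n)}. (p (f k) \<bullet> x) *s p (f k))" for x
  proof -
    have "x = transpose P *v (P *v x)"
      by (simp add: matrix_vector_mul_assoc \<open>transpose P ** P = mat 1\<close>)
    also have "\<dots> = (\<Sum>j\<in>UNIV. (p j \<bullet> x) *s p j)"
    proof -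
      have "P *v x = (\<chi> j. p j \<bullet> x)"
        by (simp add: P_def vec_eq_iff matrix_vector_mult_def inner_vec_def)
      then show ?thesis
        by (simp add: P_def vec_eq_iff matrix_vector_mult_def transpose_def) (simp add: mult.commute)
    qed
    also have "\<dots> = (\<Sum>k\<in>{1..CARD('n)}. (p (f k) \<bullet> x) *s p (f k))"
      by (rule sum.reindex_bij_betw[OF f, symmetric])
    finally show ?thesis .
  qed
  have "symmetric_eigenbasis A {1..CARD('n)} lam (\<lambda>k. p (f k))"
  proof
    show "p (f i) \<bullet> p (f j) = (if i = j then 1 else 0)"
      if "i \<in> {1..CARD('n)}" "j \<in> {1..CARD('n)}" for i j
      using inj_on_eq_iff[OF bij_betw_imp_inj_on[OF f] that] by (simp only: p)
    show "A *v p (f k) = lam k *s p (f k)" if "k \<in> {1..CARD('n)}" for k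
      using ev fl that by simp
  qed (rule A finite_atLeastAtMost expand)+
  then show ?thesis by (rule that)
qed

subsection \<open>The Moore--Penrose inverse\<close>

text \<open>\<open>A ** X\<close> and \<open>A ** Y\<close> are the same orthogonal projection, and
  so are \<open>X ** A\<close> and \<open>Y ** A\<close>; then
  \<open>X = X ** A ** X = Y ** A ** X = Y ** A ** Y = Y\<close>.\<close>

lemma is_moore_penrose_unique:
  fixes A :: "real^'n^'m"
  assumes X: "is_moore_penrose A X" and Y: "is_moore_penrose A Y"
  shows "X = Y"
proof -
  have AXA: "A ** X ** A = A" "A ** Y ** A = A" and XAX: "X ** A ** X = X" "Y ** A ** Y = Y"
    and tA: "transpose (A ** X) = A ** X" "transpose (A ** Y) = A ** Y"
    and tX: "transpose (X ** A) = X ** A" "transpose (Y ** A) = Y ** A"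
    using X Y by (auto simp only: is_moore_penrose_def)
  have "A ** X = A ** Y"
  proof -
    \<comment> \<open>The product of the two projections collapses to \<open>A ** X\<close> in one
      order and to \<open>A ** Y\<close> in the other; transposition exchanges the orders.\<close>
    have "A ** X = transpose ((A ** Y) ** (A ** X))"
      by (simp only: matrix_mul_assoc AXA tA)
    also have "\<dots> = (A ** X) ** (A ** Y)"
      by (simp only: matrix_transpose_mul[of "A ** Y"] tA)
    also have "\<dots> = A ** Y"
      by (simp only: matrix_mul_assoc AXA)
    finally show ?thesis .
  qed
  moreover have "X ** A = Y ** A"
  proof -
    have "X ** A = transpose ((X ** A) ** (Y ** A))"
      by (simp only: matrix_mul_assoc[symmetric] AXA[unfolded matrix_mul_assoc[symmetric]] tX)
    also have "\<dots> = (Y ** A) ** (X ** A)"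
      by (simp only: matrix_transpose_mul[of "X ** A"] tX)
    also have "\<dots> = Y ** A"
      by (simp only: matrix_mul_assoc[symmetric] AXA[unfolded matrix_mul_assoc[symmetric]])
    finally show ?thesis .
  qed
  ultimately show ?thesis
    by (metis XAX matrix_mul_assoc)
qed

lemma moore_penrose_eq:
  assumes "is_moore_penrose A X"
  shows "moore_penrose A = X"
  unfolding moore_penrose_def using assms is_moore_penrose_unique by (intro the_equality)

lemma (in symmetric_eigenbasis) parseval:
  "x \<bullet> y = (\<Sum>k\<in>I. (q k \<bullet> x) * (q k \<bullet> y))"
proof -
  have "x \<bullet> y = (\<Sum>k\<in>I. (q k \<bullet> x) *s q k) \<bullet> y"
    by (rule arg_cong[where f = "\<lambda>z. z \<bullet> y", OF expansion])
  then show ?thesis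
    by (simp add: inner_sum_left scalar_mult_eq_scaleR)
qed

text \<open>Reduces the first two Penrose equations, and commutation, to scalar identities in
  \<open>lam k\<close>.\<close>

lemma (in symmetric_eigenbasis) matrix_eqI:
  fixes B C :: "real^'n^'m"
  assumes "\<And>k. k \<in> I \<Longrightarrow> B *v q k = C *v q k"
  shows "B = C"
proof -
  have "B *v x = C *v x" for x
  proof -
    have D: "D *v x = (\<Sum>k\<in>I. (q k \<bullet> x) *s (D *v q k))" for D :: "real^'n^'m"
    proof -
      have "D *v x = D *v (\<Sum>k\<in>I. (q k \<bullet> x) *s q k)"
        by (rule arg_cong[where f = "\<lambda>z. D *v z", OF expansion])
      also have "\<dots> = (\<Sum>k\<in>I. (q k \<bullet> x) *s (D *v q k))"
        by (simp add: linear_sum[OF matrix_vector_mul_linear] vec.scale matrix_vector_mult_scaleR scalar_mult_eq_scaleR)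
      finally show ?thesis .
    qed
    show ?thesis
      unfolding D using assms by simp
  qed
  then show ?thesis by (simp add: matrix_eq)
qed

text \<open>On the kernel the factor \<open>inverse (lam k)\<close> is \<open>inverse 0 = 0\<close>, as it should be.\<close>

lemma (in symmetric_eigenbasis) moore_penrose:
  shows transpose_moore_penrose: "transpose (moore_penrose A) = moore_penrose A"
    and moore_penrose_eigenvector: "k \<in> I \<Longrightarrow> moore_penrose A *v q k = inverse (lam k) *s q k"
proof -
  define X :: "real^'n^'n" where "X = (\<chi> i j. \<Sum>k\<in>I. inverse (lam k) * q k $ i * q k $ j)"
  have sym: "transpose X = X"
    by (simp add: X_def transpose_def vec_eq_iff mult.assoc mult.left_commute mult.commute)
  have X: "X *v q k = inverse (lam k) *s q k" if "k \<in> I" for k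
  proof -
    have "(X *v q k) $ i = inverse (lam k) * q k $ i" for i
    proof -
      have "(X *v q k) $ i = (\<Sum>j\<in>UNIV. \<Sum>l\<in>I. inverse (lam l) * q l $ i * q l $ j * q k $ j)"
        by (simp add: X_def matrix_vector_mult_def sum_distrib_right)
      also have "\<dots> = (\<Sum>l\<in>I. inverse (lam l) * q l $ i * (q l \<bullet> q k))"
        by (subst sum.swap) (simp add: inner_vec_def sum_distrib_left mult.assoc)
      also have "\<dots> = (\<Sum>l\<in>I. if l = k then inverse (lam k) * q k $ i else 0)"
        by (rule sum.cong) (auto simp: orthonormal that)
      finally show ?thesis
        using that finite_index by simp
    qed
    then show ?thesis by (simp add: vec_eq_iff)
  qed
  \<comment> \<open>Both products scale \<open>q k\<close> by
    \<open>lam k * inverse (lam k)\<close>. Commutation yields the symmetry demanded by the last two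
    Penrose equations.\<close>
  have AX: "A ** X = X ** A"
    by (rule matrix_eqI)
      (simp add: matrix_vector_mul_assoc[symmetric] X eigenvector matrix_vector_mult_scaleR scalar_mult_eq_scaleR mult.commute)
  have "is_moore_penrose A X"
    unfolding is_moore_penrose_def
  proof (intro conjI)
    show "A ** X ** A = A"
      by (rule matrix_eqI)
        (auto simp: matrix_vector_mul_assoc[symmetric] X eigenvector matrix_vector_mult_scaleR scalar_mult_eq_scaleR)
    show "X ** A ** X = X"
      by (rule matrix_eqI)
        (auto simp: matrix_vector_mul_assoc[symmetric] X eigenvector matrix_vector_mult_scaleR scalar_mult_eq_scaleR)
    show "transpose (A ** X) = A ** X" "transpose (X ** A) = X ** A"
      by (simp_all add: matrix_transpose_mul sym symmetric AX)
  qed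
  then have "moore_penrose A = X" by (rule moore_penrose_eq)
  then show "transpose (moore_penrose A) = moore_penrose A"
    and "k \<in> I \<Longrightarrow> moore_penrose A *v q k = inverse (lam k) *s q k"
    using sym X by auto
qed

text \<open>Eigenvectors for different eigenvalues are orthogonal, so the \<open>q i\<close> sharing
  the eigenvalue \<open>lam k\<close> span its eigenspace; all of them must be tested, not only
  \<open>q k\<close>.\<close>

lemma (in symmetric_eigenbasis) eigenspace_orthogonal_comp_iff:
  assumes "k \<in> I"
  shows "x \<in> (eigenspace A (lam k))\<^sup>\<bottom> \<longleftrightarrow> (\<forall>i\<in>I. lam i = lam k \<longrightarrow> q i \<bullet> x = 0)"
proof
  assume "x \<in> (eigenspace A (lam k))\<^sup>\<bottom>"
  then show "\<forall>i\<in>I. lam i = lam k \<longrightarrow> q i \<bullet> x = 0"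
    using eigenvector by (auto simp: orthogonal_comp_def orthogonal_def eigenspace_def)
next
  assume x: "\<forall>i\<in>I. lam i = lam k \<longrightarrow> q i \<bullet> x = 0"
  have "y \<bullet> x = 0" if y: "A *v y = lam k *s y" for y
  proof -
    have "q i \<bullet> y = 0" if "i \<in> I" "lam i \<noteq> lam k" for i
    proof -
      have "lam i * (q i \<bullet> y) = lam k * (q i \<bullet> y)"
        using symmetric_matrix_inner[OF symmetric, of "q i" y] y that
        by (simp add: eigenvector scalar_mult_eq_scaleR)
      then show ?thesis using that by simp
    qed
    then show ?thesis
      unfolding parseval[of y] using x by (intro sum.neutral) auto
  qed
  then show "x \<in> (eigenspace A (lam k))\<^sup>\<bottom>"
    by (auto simp: orthogonal_comp_def orthogonal_def eigenspace_def)
qed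

section \<open>Biharmonic distance in eigenbasis coordinates\<close>

lemma inner_axis_diff:
  fixes M :: "real^'n^'n"
  assumes "transpose M = M"
  shows "(axis u 1 - axis v 1) \<bullet> (M *v (axis u 1 - axis v 1)) = M $ u $ u + M $ v $ v - 2 * M $ u $ v"
proof -
  have "M $ v $ u = M $ u $ v"
    using arg_cong[OF assms, of "\<lambda>N. N $ u $ v"] by (simp add: transpose_def)
  then show ?thesis
    by (simp add: matrix_vector_mult_diff_distrib matrix_vector_mult_basis column_def
        inner_diff_left inner_axis')
qed

text \<open>Parseval for \<open>X *v w\<close>. Indices with \<open>lam k = 0\<close> add nothing
  because \<open>inverse 0 = 0\<close>, so the sum may run over all of \<open>I\<close>.\<close>

lemma biharmonic_distance_eigenbasis:
  assumes "symmetric_eigenbasis (laplacian G) I lam q"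
  shows "biharmonic_distance G u v =
    sqrt (\<Sum>k\<in>I. (q k \<bullet> (axis u 1 - axis v 1))\<^sup>2 * (inverse (lam k))\<^sup>2)"
proof -
  interpret symmetric_eigenbasis "laplacian G" I lam q by fact
  define X where "X = moore_penrose (laplacian G)"
  define w :: "real^'a" where "w = axis u 1 - axis v 1"
  have sym: "transpose X = X"
    unfolding X_def by (rule transpose_moore_penrose)
  then have "transpose (X ** X) = X ** X"
    by (simp add: matrix_transpose_mul)
  then have "biharmonic_distance G u v = sqrt (w \<bullet> ((X ** X) *v w))"
    by (simp add: biharmonic_distance_def X_def[symmetric] Let_def w_def inner_axis_diff)
  also have "w \<bullet> ((X ** X) *v w) = (X *v w) \<bullet> (X *v w)"
    by (simp add: matrix_vector_mul_assoc[symmetric] symmetric_matrix_inner[OF sym])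
  also have "\<dots> = (\<Sum>k\<in>I. (q k \<bullet> w)\<^sup>2 * (inverse (lam k))\<^sup>2)"
  proof -
    have "q k \<bullet> (X *v w) = inverse (lam k) * (q k \<bullet> w)" if "k \<in> I" for k
      using that symmetric_matrix_inner[OF sym, of "q k" w]
      by (simp add: X_def moore_penrose_eigenvector scalar_mult_eq_scaleR)
    then show ?thesis
      unfolding parseval[of "X *v w"]
      by (intro sum.cong) (auto simp: power2_eq_square)
  qed
  finally show ?thesis by (simp add: w_def)
qed

subsection \<open>Graph Laplacians\<close>

lemma dominates_sym:
  assumes "graph G"
  shows "i \<rightarrow>\<^bsub>G\<^esub> j \<longleftrightarrow> j \<rightarrow>\<^bsub>G\<^esub> i"
proof -
  interpret graph G by fact
  show ?thesis by (rule iffI; erule arcs_ends_symmetric[OF sym_arcs])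
qed

text \<open>Absence of parallel arcs makes the head map injective on out-arcs, so counting arcs is
  counting neighbours.\<close>

lemma out_degree_eq_card_dominates:
  assumes "graph G"
  shows "out_degree G i = card {j. i \<rightarrow>\<^bsub>G\<^esub> j}"
proof -
  interpret graph G by fact
  have "bij_betw (head G) (out_arcs G i) {j. i \<rightarrow>\<^bsub>G\<^esub> j}"
    unfolding bij_betw_def
  proof
    show "inj_on (head G) (out_arcs G i)"
      using no_multi_arcs by (auto simp: inj_on_def arc_to_ends_def)
    show "head G ` out_arcs G i = {j. i \<rightarrow>\<^bsub>G\<^esub> j}"
      by (auto simp: arcs_ends_def arc_to_ends_def)
  qed
  then show ?thesis
    unfolding out_degree_def by (rule bij_betw_same_card)
qed

lemma laplacian_mult_nth:
  assumes "graph G"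
  shows "(laplacian G *v x) $ i = (\<Sum>j\<in>UNIV. if i \<rightarrow>\<^bsub>G\<^esub> j then x $ i - x $ j else 0)"
proof -
  have "(degree_matrix G *v x) $ i = real (out_degree G i) * x $ i"
    by (simp add: degree_matrix_def matrix_vector_mult_def mult_delta_left)
  also have "\<dots> = (\<Sum>j\<in>UNIV. if i \<rightarrow>\<^bsub>G\<^esub> j then x $ i else 0)"
    by (simp add: out_degree_eq_card_dominates[OF assms] sum.If_cases)
  finally show ?thesis
    unfolding laplacian_def matrix_vector_mult_diff_rdistrib
    by (simp add: adjacency_matrix_def matrix_vector_mult_def mult_delta_left sum_subtractf[symmetric])
       (intro sum.cong, auto)
qed

lemma transpose_laplacian:
  assumes "graph G"
  shows "transpose (laplacian G) = laplacian G"
proof -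
  have "laplacian G $ j $ i = laplacian G $ i $ j" for i j
    using dominates_sym[OF assms, of i j]
    by (cases "i = j") (simp_all add: laplacian_def degree_matrix_def adjacency_matrix_def)
  then show ?thesis by (simp add: transpose_def vec_eq_iff)
qed

text \<open>Ordered pairs meet each undirected edge twice, whence the factor 2. This form gives both
  the sign of the eigenvalues and the kernel.\<close>

lemma laplacian_quadratic_form:
  assumes "graph G"
  shows "2 * (x \<bullet> (laplacian G *v x)) =
    (\<Sum>i\<in>UNIV. \<Sum>j\<in>UNIV. if i \<rightarrow>\<^bsub>G\<^esub> j then (x $ i - x $ j)\<^sup>2 else 0)"
proof -
  define a where "a i j = (if i \<rightarrow>\<^bsub>G\<^esub> j then 1 else 0 :: real)" for i j
  have a: "a i j = a j i" for i j
    using dominates_sym[OF assms] by (auto simp: a_def)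
  have S: "x \<bullet> (laplacian G *v x) = (\<Sum>i\<in>UNIV. \<Sum>j\<in>UNIV. a i j * (x $ i * (x $ i - x $ j)))"
    unfolding inner_vec_def laplacian_mult_nth[OF assms] sum_distrib_left
    by (intro sum.cong refl) (auto simp: a_def sum_distrib_left intro!: sum.cong)
  \<comment> \<open>The indices are renamed using the symmetry of \<open>a\<close>; adding both
    versions completes the square.\<close>
  also have "\<dots> = (\<Sum>i\<in>UNIV. \<Sum>j\<in>UNIV. a i j * (x $ j * (x $ j - x $ i)))"
    by (subst sum.swap) (simp only: a)
  finally have "2 * (x \<bullet> (laplacian G *v x)) =
      (\<Sum>i\<in>UNIV. \<Sum>j\<in>UNIV. a i j * (x $ i * (x $ i - x $ j)) + a i j * (x $ j * (x $ j - x $ i)))"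
    using S by (simp add: sum.distrib)
  also have "\<dots> = (\<Sum>i\<in>UNIV. \<Sum>j\<in>UNIV. if i \<rightarrow>\<^bsub>G\<^esub> j then (x $ i - x $ j)\<^sup>2 else 0)"
    by (intro sum.cong refl) (simp add: a_def power2_eq_square algebra_simps)
  finally show ?thesis .
qed

text \<open>The quadratic form vanishes at \<open>x\<close>, hence so does each of its squares:
  \<open>x\<close> is constant along arcs and thus along walks.\<close>

lemma laplacian_kernel_constant:
  fixes G :: "('n::finite, 'b) pre_digraph"
  assumes G: "graph G" "verts G = UNIV" "Digraph_Component.connected G"
    and x: "laplacian G *v x = 0"
  shows "x $ i = x $ j"
proof -
  interpret graph G by fact
  have edge: "x $ k = x $ l" if "k \<rightarrow>\<^bsub>G\<^esub> l" for k l
  proof -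
    have "(\<Sum>i\<in>UNIV. \<Sum>j\<in>UNIV. if i \<rightarrow>\<^bsub>G\<^esub> j then (x $ i - x $ j)\<^sup>2 else 0) = 0"
      using laplacian_quadratic_form[OF G(1), of x] x by simp
    then have "(\<Sum>j\<in>UNIV. if k \<rightarrow>\<^bsub>G\<^esub> j then (x $ k - x $ j)\<^sup>2 else 0) = 0"
      by (subst (asm) sum_nonneg_eq_0_iff) (auto intro!: sum_nonneg)
    then have "(if k \<rightarrow>\<^bsub>G\<^esub> l then (x $ k - x $ l)\<^sup>2 else 0) = 0"
      by (subst (asm) sum_nonneg_eq_0_iff) auto
    then show ?thesis using that by simp
  qed
  \<comment> \<open>\<open>connected\<close> ignores arc directions; symmetry of the arcs turns it
    into directed reachability.\<close>
  have "i \<rightarrow>\<^sup>*\<^bsub>G\<^esub> j"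
    using symmetric_connected_imp_strongly_connected[OF sym_arcs G(3)] G(2)
    by (auto simp: strongly_connected_def)
  then show ?thesis
    by (induction rule: reachable_induct) (auto simp: edge)
qed

text \<open>The arc of the complete graph joining the images of \<open>i\<close> and
  \<open>j\<close> is pulled back to \<open>G\<close>.\<close>

lemma digraph_iso_complete_graph_dominates:
  fixes G :: "('n::finite, 'b) pre_digraph"
  assumes G: "graph G" "verts G = UNIV"
    and iso: "digraph_iso G (with_proj (complete_graph CARD('n)))" and "i \<noteq> j"
  shows "i \<rightarrow>\<^bsub>G\<^esub> j"
proof -
  let ?K = "with_proj (complete_graph CARD('n))"
  obtain f where f: "pre_digraph.digraph_isomorphism G f" and K: "?K = app_iso f G"
    using iso by (auto simp: digraph_iso_def)
  have inj: "iso_verts f k = iso_verts f l \<longleftrightarrow> k = l" for k l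
    using pre_digraph.iso_verts_eq_iff[OF f] G(2) by auto
  have "iso_verts f k \<in> verts ?K" for k
    unfolding K using G(2) by simp
  then have "(iso_verts f i, iso_verts f j) \<in> arcs ?K"
    using inj \<open>i \<noteq> j\<close> by (auto simp: complete_graph_def)
  then obtain e where e: "e \<in> arcs G" "iso_arcs f e = (iso_verts f i, iso_verts f j)"
    unfolding K by auto
  \<comment> \<open>Arcs of the complete graph are pairs, so \<open>K\<close> forces the tail and
    head maps of the image to be the projections.\<close>
  have "iso_tail f = fst" "iso_head f = snd"
    using arg_cong[OF K, of tail] arg_cong[OF K, of head] by auto
  then have "tail G e = i" "head G e = j"
    using pre_digraph.iso_verts_tail[OF f e(1)] pre_digraph.iso_verts_head[OF f e(1)] e(2) inj
    by auto
  then show ?thesis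
    using e(1) by (auto simp: arcs_ends_def arc_to_ends_def intro!: image_eqI[of _ _ e])
qed

section \<open>Weighted sums and their equality cases\<close>

lemma weighted_sum_le:
  fixes c r :: "'i \<Rightarrow> real"
  assumes "finite I" and le: "\<And>i. i \<in> I \<Longrightarrow> r i \<le> R"
  shows "(\<Sum>i\<in>I. (c i)\<^sup>2 * r i) \<le> R * (\<Sum>i\<in>I. (c i)\<^sup>2)"
    and "(\<Sum>i\<in>I. (c i)\<^sup>2 * r i) = R * (\<Sum>i\<in>I. (c i)\<^sup>2) \<longleftrightarrow> (\<forall>i\<in>I. r i < R \<longrightarrow> c i = 0)"
proof -
  \<comment> \<open>The deficit is a sum of nonnegative terms, which settles the bound and the
    equality case together.\<close>
  have eq: "R * (\<Sum>i\<in>I. (c i)\<^sup>2) - (\<Sum>i\<in>I. (c i)\<^sup>2 * r i) = (\<Sum>i\<in>I. (c i)\<^sup>2 * (R - r i))"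
    by (simp add: sum_distrib_left sum_subtractf[symmetric] algebra_simps)
  have nonneg: "0 \<le> (c i)\<^sup>2 * (R - r i)" if "i \<in> I" for i
    using le[OF that] by simp
  then have "0 \<le> (\<Sum>i\<in>I. (c i)\<^sup>2 * (R - r i))"
    by (rule sum_nonneg)
  then show "(\<Sum>i\<in>I. (c i)\<^sup>2 * r i) \<le> R * (\<Sum>i\<in>I. (c i)\<^sup>2)"
    using eq by linarith
  have "(\<Sum>i\<in>I. (c i)\<^sup>2 * (R - r i)) = 0 \<longleftrightarrow> (\<forall>i\<in>I. (c i)\<^sup>2 * (R - r i) = 0)"
    using \<open>finite I\<close> nonneg by (rule sum_nonneg_eq_0_iff)
  also have "\<dots> \<longleftrightarrow> (\<forall>i\<in>I. r i < R \<longrightarrow> c i = 0)"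
    using le by (intro ball_cong refl) force
  finally show "(\<Sum>i\<in>I. (c i)\<^sup>2 * r i) = R * (\<Sum>i\<in>I. (c i)\<^sup>2) \<longleftrightarrow> (\<forall>i\<in>I. r i < R \<longrightarrow> c i = 0)"
    using eq by linarith
qed

lemma weighted_sum_ge:
  fixes c r :: "'i \<Rightarrow> real"
  assumes "finite I" and ge: "\<And>i. i \<in> I \<Longrightarrow> R \<le> r i"
  shows "R * (\<Sum>i\<in>I. (c i)\<^sup>2) \<le> (\<Sum>i\<in>I. (c i)\<^sup>2 * r i)"
    and "(\<Sum>i\<in>I. (c i)\<^sup>2 * r i) = R * (\<Sum>i\<in>I. (c i)\<^sup>2) \<longleftrightarrow> (\<forall>i\<in>I. R < r i \<longrightarrow> c i = 0)"
  using weighted_sum_le[of I "\<lambda>i. - r i" "- R" c] assms by (simp_all add: sum_negf)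

section \<open>Spectra of connected and of complete graphs\<close>

lemma graph_laplacian_spectrum:
  fixes G :: "('n::finite, 'b) pre_digraph"
  assumes G: "graph G" "verts G = UNIV" "Digraph_Component.connected G"
    and lam: "mono_on {1..CARD('n)} lam"
    and eb: "symmetric_eigenbasis (laplacian G) {1..CARD('n)} lam q"
  shows laplacian_eigenvector_1: "\<exists>c. c \<noteq> 0 \<and> q 1 = c *s 1"
    and laplacian_eigenvalue_1: "lam 1 = 0"
    and laplacian_eigenvalue_pos: "\<And>k. k \<in> {2..CARD('n)} \<Longrightarrow> lam k > 0"
proof -
  interpret symmetric_eigenbasis "laplacian G" "{1..CARD('n)}" lam q by fact
  have 1: "1 \<in> {1..CARD('n)}"
    by (simp add: Suc_leI)
  have nonneg: "lam k \<ge> 0" if k: "k \<in> {1..CARD('n)}" for k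
  proof -
    have "2 * lam k = 2 * (q k \<bullet> (laplacian G *v q k))"
      using orthonormal[OF k k] by (simp add: eigenvector[OF k] scalar_mult_eq_scaleR)
    also have "\<dots> \<ge> 0"
      unfolding laplacian_quadratic_form[OF G(1)] by (intro sum_nonneg) auto
    finally show ?thesis by simp
  qed
  have L1: "laplacian G *v 1 = 0"
    by (simp add: vec_eq_iff laplacian_mult_nth[OF G(1)] cong: if_cong)
  \<comment> \<open>Otherwise \<open>lam k * (q k \<bullet> 1) = 0\<close> would kill every
    coefficient of the all-ones vector, against Parseval.\<close>
  have "\<exists>k\<in>{1..CARD('n)}. lam k = 0"
  proof (rule ccontr)
    assume "\<not> ?thesis"
    then have "q k \<bullet> 1 = 0" if "k \<in> {1..CARD('n)}" for k
      using that symmetric_matrix_inner[OF symmetric, of "q k" 1]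
      by (simp add: eigenvector L1 scalar_mult_eq_scaleR)
    then have "(1 :: real^'n) \<bullet> 1 = 0"
      unfolding parseval[of 1] by simp
    then show False by simp
  qed
  then show lam1: "lam 1 = 0"
    using lam nonneg 1 unfolding mono_on_def by (metis antisym atLeastAtMost_iff)
  have kernel: "\<exists>c. c \<noteq> 0 \<and> q k = c *s 1" if k: "k \<in> {1..CARD('n)}" "lam k = 0" for k
  proof -
    have "laplacian G *v q k = 0"
      using eigenvector[OF k(1)] k(2) by simp
    then have "q k $ i = q k $ undefined" for i
      by (rule laplacian_kernel_constant[OF G])
    then have qk: "q k = (q k $ undefined) *s 1"
      by (simp add: vec_eq_iff)
    moreover have "q k \<noteq> 0"
      using orthonormal[OF k(1) k(1)] by auto
    ultimately show ?thesis
      by (metis vector_smult_lzero)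
  qed
  then show "\<exists>c. c \<noteq> 0 \<and> q 1 = c *s 1"
    using 1 lam1 by blast
  show "lam k > 0" if k: "k \<in> {2..CARD('n)}" for k
  proof (rule ccontr)
    have k': "k \<in> {1..CARD('n)}" "k \<noteq> 1" using k by auto
    assume "\<not> lam k > 0"
    then have "lam k = 0" using nonneg[OF k'(1)] by simp
    \<comment> \<open>A second zero eigenvalue would give two nonzero constant vectors, which cannot
      be orthogonal.\<close>
    then obtain c d where "c \<noteq> 0" "q 1 = c *s 1" "d \<noteq> 0" "q k = d *s 1"
      using kernel 1 k' lam1 by metis
    then have "q 1 \<bullet> q k \<noteq> 0"
      by (simp add: scalar_mult_eq_scaleR)
    then show False
      using orthonormal[OF 1 k'(1)] k'(2) by simp
  qed
qed

text \<open>The summand for \<open>j = i\<close> is zero, so the Laplacian sums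
  \<open>x $ i - x $ j\<close> over all \<open>j\<close>; as the coordinates of \<open>x\<close> sum
  to zero, this is multiplication by \<open>CARD('n)\<close>.\<close>

lemma complete_graph_laplacian_eigenvalue:
  fixes G :: "('n::finite, 'b) pre_digraph"
  assumes "graph G" and complete: "\<And>i j. i \<noteq> j \<Longrightarrow> i \<rightarrow>\<^bsub>G\<^esub> j"
    and x: "laplacian G *v x = \<mu> *s x" "1 \<bullet> x = 0" "x \<noteq> 0"
  shows "\<mu> = CARD('n)"
proof -
  have "(laplacian G *v x) $ i = CARD('n) * x $ i" for i
  proof -
    have "(laplacian G *v x) $ i = (\<Sum>j\<in>UNIV. x $ i - x $ j)"
      unfolding laplacian_mult_nth[OF assms(1)]
      by (intro sum.cong refl) (metis complete diff_self)
    then show ?thesis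
      using x(2) by (simp add: sum_subtractf inner_vec_def)
  qed
  then have "\<mu> *s x = CARD('n) *s x"
    unfolding x(1)[symmetric] by (simp add: vec_eq_iff)
  then show ?thesis
    using x(3) by (simp add: vec_eq_iff) metis
qed

theorem theorem3p2:
  fixes G :: "('n::finite, 'b) pre_digraph"
    and lam :: "nat \<Rightarrow> real"
    and u v :: 'n
  assumes "graph G"
    and "verts G = UNIV"
    and "Digraph_Component.connected G"
    and "ordered_eigenvalues (laplacian G) lam"
    and "u \<noteq> v"
  shows "sqrt 2 * inverse (lam CARD('n)) \<le> biharmonic_distance G u v \<and>
    biharmonic_distance G u v \<le> sqrt 2 * inverse (lam 2) \<and>
    (biharmonic_distance G u v = sqrt 2 * inverse (lam 2) \<longleftrightarrow>
      digraph_iso G (with_proj (complete_graph CARD('n))) \<or>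
      (\<forall>k \<in> {k. 3 \<le> k \<and> k \<le> CARD('n) \<and> lam k > lam 2}.
        axis u 1 - axis v 1 \<in> (eigenspace (laplacian G) (lam k))\<^sup>\<bottom>)) \<and>
    (biharmonic_distance G u v = sqrt 2 * inverse (lam CARD('n)) \<longleftrightarrow>
      digraph_iso G (with_proj (complete_graph CARD('n))) \<or>
      (\<forall>k \<in> {k. 2 \<le> k \<and> k \<le> CARD('n) - 1 \<and> lam k < lam CARD('n)}.
        axis u 1 - axis v 1 \<in> (eigenspace (laplacian G) (lam k))\<^sup>\<bottom>))"
proof -
  let ?n = "CARD('n)" and ?L = "laplacian G"
  let ?K = "digraph_iso G (with_proj (complete_graph ?n))"
  obtain q where eb: "symmetric_eigenbasis ?L {1..?n} lam q"
    using ordered_eigenvalues_eigenbasis[OF transpose_laplacian[OF assms(1)] assms(4)] .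
  interpret symmetric_eigenbasis ?L "{1..?n}" lam q by fact
  have mono: "mono_on {1..?n} lam"
    using assms(4) by (simp add: ordered_eigenvalues_def)
  note spectrum = graph_laplacian_spectrum[OF assms(1-3) mono eb]
  \<comment> \<open>Two distinct vertices ensure that index 2 lies in the range of
    eigenvalues.\<close>
  have "card {u, v} \<le> ?n" by (intro card_mono) auto
  then have n: "2 \<le> ?n" using assms(5) by simp
  define w :: "real^'n" where "w = axis u 1 - axis v 1"
  define d where "d = biharmonic_distance G u v"
  define c where "c k = q k \<bullet> w" for k
  define r where "r k = (inverse (lam k))\<^sup>2" for k
  obtain a where a: "a \<noteq> 0" "q 1 = a *s 1"
    using spectrum(1) by blast
  have c1: "c 1 = 0"
    unfolding c_def w_def a(2) by (simp add: inner_diff_right inner_axis)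
  have index: "{1..?n} = insert 1 {2..?n}" using n by auto
  \<comment> \<open>Used with the constant weight 1 for the norm of \<open>w\<close> and with
    \<open>r\<close> for the distance.\<close>
  have split: "(\<Sum>k\<in>{1..?n}. (c k)\<^sup>2 * g k) = (\<Sum>k\<in>{2..?n}. (c k)\<^sup>2 * g k)" for g
    unfolding index using c1 by simp
  have "w \<bullet> w = 2"
    using assms(5) by (simp add: w_def inner_diff_left inner_diff_right inner_axis_axis)
  then have norm_w: "(\<Sum>k\<in>{2..?n}. (c k)\<^sup>2) = 2"
    using parseval[of w w] split[of "\<lambda>_. 1"] by (simp add: c_def power2_eq_square)
  have d: "d = sqrt (\<Sum>k\<in>{2..?n}. (c k)\<^sup>2 * r k)"
    unfolding d_def biharmonic_distance_eigenbasis[OF eb] split[symmetric] by (simp only: c_def w_def r_def)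
  have pos: "lam k > 0" if "k \<in> {2..?n}" for k
    using spectrum(3) that .
  have lam2: "lam 2 \<le> lam k" and lamn: "lam k \<le> lam ?n" if "k \<in> {2..?n}" for k
    using mono that n by (auto simp: mono_on_def)
  \<comment> \<open>Squared reciprocals reverse the order of positive eigenvalues:
    \<open>r 2\<close> is the largest factor and \<open>r ?n\<close> the smallest.\<close>
  have r_le: "r k \<le> r l \<longleftrightarrow> lam l \<le> lam k"
    if "k \<in> {2..?n}" "l \<in> {2..?n}" for k l
    using pos[OF that(1)] pos[OF that(2)]
    by (simp add: r_def power_mono_iff)
  then have r_less: "r k < r l \<longleftrightarrow> lam l < lam k" if "k \<in> {2..?n}" "l \<in> {2..?n}" for k l
    using that by (metis not_le)
  have bound: "sqrt 2 * inverse (lam k) = sqrt (r k * 2)" if "k \<in> {2..?n}" for k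
    using pos[OF that] by (simp add: r_def real_sqrt_mult)
  have mem: "2 \<in> {2..?n}" "?n \<in> {2..?n}" using n by auto
  have upper: "r k \<le> r 2" and lower: "r ?n \<le> r k" if "k \<in> {2..?n}" for k
    using r_le that mem lam2 lamn by auto
  have bounds: "sqrt 2 * inverse (lam ?n) \<le> d" "d \<le> sqrt 2 * inverse (lam 2)"
    using weighted_sum_le(1)[of "{2..?n}" r "r 2" c] weighted_sum_ge(1)[of "{2..?n}" "r ?n" r c]
      upper lower norm_w
    by (simp_all add: bound[OF mem(1)] bound[OF mem(2)] d)
  have "d = sqrt 2 * inverse (lam 2) \<longleftrightarrow> (\<forall>k\<in>{2..?n}. r k < r 2 \<longrightarrow> c k = 0)"
    using weighted_sum_le(2)[of "{2..?n}" r "r 2" c] upper norm_w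
    by (simp add: bound[OF mem(1)] d)
  then have eq_2: "d = sqrt 2 * inverse (lam 2) \<longleftrightarrow> (\<forall>k\<in>{2..?n}. lam 2 < lam k \<longrightarrow> c k = 0)"
    using r_less mem(1) by simp
  have "d = sqrt 2 * inverse (lam ?n) \<longleftrightarrow> (\<forall>k\<in>{2..?n}. r ?n < r k \<longrightarrow> c k = 0)"
    using weighted_sum_ge(2)[of "{2..?n}" "r ?n" r c] lower norm_w
    by (simp add: bound[OF mem(2)] d)
  then have eq_n: "d = sqrt 2 * inverse (lam ?n) \<longleftrightarrow> (\<forall>k\<in>{2..?n}. lam k < lam ?n \<longrightarrow> c k = 0)"
    using r_less mem(2) by simp
  have orth: "w \<in> (eigenspace ?L (lam k))\<^sup>\<bottom> \<longleftrightarrow> (\<forall>i\<in>{2..?n}. lam i = lam k \<longrightarrow> c i = 0)"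
    if "k \<in> {2..?n}" for k
    using eigenspace_orthogonal_comp_iff[of k w] that c1 unfolding index c_def by blast
  \<comment> \<open>\<open>P\<close> sees only the eigenvalue, so the selected indices fill whole
    eigenspaces, and testing single coefficients amounts to testing eigenspaces.\<close>
  have sigma: "(\<forall>k\<in>{2..?n}. P (lam k) \<longrightarrow> c k = 0) \<longleftrightarrow>
      (\<forall>k\<in>{k\<in>{2..?n}. P (lam k)}. w \<in> (eigenspace ?L (lam k))\<^sup>\<bottom>)" for P
    using orth by (metis (mono_tags, lifting) mem_Collect_eq)
  \<comment> \<open>Strictness already rules out \<open>k = 2\<close>, so the range may start at 2;
    likewise \<open>k = ?n\<close> is ruled out below.\<close>
  have "3 \<le> k \<longleftrightarrow> 2 \<le> k" if "lam 2 < lam k" for k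
    using that by (cases "k = 2") auto
  then have sigma_2: "{k. 3 \<le> k \<and> k \<le> ?n \<and> lam k > lam 2} = {k\<in>{2..?n}. lam 2 < lam k}"
    by auto
  have "k \<le> ?n - 1 \<longleftrightarrow> k \<le> ?n" if "lam k < lam ?n" for k
    using that n by (cases "k = ?n") auto
  then have sigma_n: "{k. 2 \<le> k \<and> k \<le> ?n - 1 \<and> lam k < lam ?n} = {k\<in>{2..?n}. lam k < lam ?n}"
    by auto
  have "lam k = ?n" if ?K "k \<in> {2..?n}" for k
  proof (rule complete_graph_laplacian_eigenvalue[OF assms(1)])
    have k: "k \<in> {1..?n}" "k \<noteq> 1" using that(2) by auto
    show "i \<rightarrow>\<^bsub>G\<^esub> j" if "i \<noteq> j" for i j
      using digraph_iso_complete_graph_dominates[OF assms(1,2) \<open>?K\<close> that] .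
    show "?L *v q k = lam k *s q k" using eigenvector[OF k(1)] .
    show "q k \<noteq> 0" using orthonormal[OF k(1) k(1)] by auto
    \<comment> \<open>\<open>q 1\<close> is a nonzero multiple of the all-ones vector and orthogonal
      to \<open>q k\<close>.\<close>
    show "1 \<bullet> q k = 0"
      using orthonormal[of 1 k] k n a by (simp add: scalar_mult_eq_scaleR)
  qed
  then have complete: "?K \<Longrightarrow> \<forall>k\<in>{2..?n}. lam 2 < lam k \<longrightarrow> c k = 0"
    "?K \<Longrightarrow> \<forall>k\<in>{2..?n}. lam k < lam ?n \<longrightarrow> c k = 0"
    using mem by (metis less_irrefl)+
  \<comment> \<open>Since \<open>?K\<close> implies both coefficient conditions, the disjunct is
    absorbed by them.\<close>
  show ?thesis
    unfolding d_def[symmetric] w_def[symmetric] sigma_2 sigma_n eq_2 eq_n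
      sigma[of "\<lambda>x. lam 2 < x", symmetric] sigma[of "\<lambda>x. x < lam ?n", symmetric]
    using bounds complete by blast
qed

end
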